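(* Let $L$ be the weighted Laplacian matrix of an undirected, simple graph on $n$ vertices with non-negative edge weights. Let $m$ be a positive integer and consider a function of the form $$F(L) = \sum_{k_1,k_2,\ldots,k_m = 1}^n f(\lambda_{k_1}, \lambda_{k_2}, \ldots, \lambda_{k_m}),$$ where $\lambda_1,\lambda_2,\ldots,\lambda_n$ are the eigenvalues of $L$ (with multiplicity) and $f:\mathbb{R}_{\geq 0}^m \rightarrow \mathbb{R}$ is any real-valued function. (i) If $f$ is of class $\mathcal{C}^m$ and monotonically increasing with respect to each of its inputs, then $F(L)$ is monotonically increasing with respect to the edge weights. (ii) If $f$ is of class $\mathcal{C}^0$ and convex, then $F(L)$ is convex with respect to the edge weights.
   Context: For an undirected simple graph with vertex set $\{1,\ldots,n\}$ and edge set $\mathcal{E}$, with real non-negative weights $w_{ij}=w_{ji}$ on edges $\{i,j\}\in\mathcal{E}$ (and $w_{ij}=0$ if $\{i,j\}\notin\mathcal{E}$), the weighted Laplacian is the $n\times n$ matrix with $[L]_{ij}=-w_{ij}$ for $i\ne j$ and $[L]_{ii}=\sum_{k=1}^n w_{ik}$. It is real symmetric positive semi-definite, so its eigenvalues lie in $\mathbb{R}_{\ge 0}$. For a fixed graph, $F(L)$ is regarded as a function of the edge weights $(w_{ij})_{\{i,j\}\in\mathcal{E}}\in\mathbb{R}_{\geq 0}^{\mathcal{E}}$. "Monotonically increasing" is in the weak sense (non-decreasing), in each variable separately. *)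

theory Defs
  imports "HOL-Analysis.Analysis" "Jordan_Normal_Form.Char_Poly"
begin

no_notation Matrix.vec_index (infixl "$" 100)

definition simple_graph :: "nat \<Rightarrow> nat set set \<Rightarrow> bool" where
  "simple_graph n E \<longleftrightarrow> (\<forall>e\<in>E. e \<subseteq> {..<n} \<and> card e = 2)"

text \<open>
  Vertices are numbered from 0, as are the rows of a matrix. An edge weighting assigns a real
  number to each edge, an edge being the set of its two ends, so that the symmetry of the weights
  is built in. Only the values on \<open>E\<close> matter: all functions below ignore the values elsewhere, so a
  function of \<open>w\<close> is a function on the space of families of reals indexed by \<open>E\<close>.
\<close>

definition nonneg_weights :: "nat set set \<Rightarrow> (nat set \<Rightarrow> real) set" where
  "nonneg_weights E = {w. \<forall>e\<in>E. 0 \<le> w e}"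

definition weight :: "nat set set \<Rightarrow> (nat set \<Rightarrow> real) \<Rightarrow> nat \<Rightarrow> nat \<Rightarrow> real" where
  "weight E w i j = (if {i, j} \<in> E then w {i, j} else 0)"

definition laplacian :: "nat \<Rightarrow> nat set set \<Rightarrow> (nat set \<Rightarrow> real) \<Rightarrow> real mat" where
  "laplacian n E w = Matrix.mat n n (\<lambda>(i, j).
     if i = j then \<Sum>k<n. weight E w i k else - weight E w i j)"

text \<open>
  The real eigenvalues with algebraic multiplicity, in increasing order. For a real symmetric matrix
  the characteristic polynomial splits over the reals, so the list has as many entries as the
  matrix has rows.
\<close>

definition eigenvalue_list :: "real mat \<Rightarrow> real list" where
  "eigenvalue_list A = sorted_list_of_multiset (proots (char_poly A))"

text \<open>
  The number \<open>m\<close> of arguments of \<open>f\<close> is \<open>CARD('m)\<close>; the sum ranges over all families of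
  indices \<open>k\<close>, one index for each argument.
\<close>

definition spectral_sum :: "(real ^ 'm \<Rightarrow> real) \<Rightarrow> real mat \<Rightarrow> real" where
  "spectral_sum f A =
     (\<Sum>k \<in> {k :: 'm \<Rightarrow> nat. \<forall>j. k j < dim_row A}. f (\<chi> j. eigenvalue_list A ! k j))"

definition nonneg_orthant :: "(real ^ 'm) set" where
  "nonneg_orthant = {x. \<forall>i. 0 \<le> x $ i}"

text \<open>
  Differentiability class \<open>C\<^sup>k\<close> on a set \<open>S\<close>, with derivatives taken within \<open>S\<close>. It is meant for
  convex sets with nonempty interior, such as the orthant, on which these derivatives are
  unique; at boundary points they are one-sided.
\<close>

primrec C_k_on :: "nat \<Rightarrow> ('a::euclidean_space \<Rightarrow> real) \<Rightarrow> 'a set \<Rightarrow> bool" where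
  "C_k_on 0 f S \<longleftrightarrow> continuous_on S f"
| "C_k_on (Suc k) f S \<longleftrightarrow>
     (\<exists>D. (\<forall>x\<in>S. (f has_derivative D x) (at x within S)) \<and>
          (\<forall>b\<in>Basis. C_k_on k (\<lambda>x. D x b) S))"

definition increasing_in_each_input :: "(real ^ 'm \<Rightarrow> real) \<Rightarrow> bool" where
  "increasing_in_each_input f \<longleftrightarrow>
     (\<forall>x\<in>nonneg_orthant. \<forall>i. \<forall>t\<ge>x $ i. f x \<le> f (\<chi> j. if j = i then t else x $ j))"

definition increasing_in_weights :: "nat set set \<Rightarrow> ((nat set \<Rightarrow> real) \<Rightarrow> real) \<Rightarrow> bool" where
  "increasing_in_weights E G \<longleftrightarrow>
     (\<forall>w\<in>nonneg_weights E. \<forall>e\<in>E. \<forall>t\<ge>w e. G w \<le> G (w(e := t)))"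

text \<open>
  The library's \<open>convex_on\<close> needs a real vector space, which function types are not there.
\<close>

definition convex_in_weights :: "nat set set \<Rightarrow> ((nat set \<Rightarrow> real) \<Rightarrow> real) \<Rightarrow> bool" where
  "convex_in_weights E G \<longleftrightarrow>
     (\<forall>w\<in>nonneg_weights E. \<forall>w'\<in>nonneg_weights E. \<forall>u\<ge>0. \<forall>v\<ge>0. u + v = 1 \<longrightarrow>
        G (\<lambda>e. u * w e + v * w' e) \<le> u * G w + v * G w')"

end

theory Submission
  imports Defs "Jordan_Normal_Form.Schur_Decomposition"
begin

text \<open>
  Both parts rest on the quadratic form of the Laplacian,
  \<open>x \<bullet> L x = (\<Sum>i j. w i j * (x i - x j)\<^sup>2) / 2\<close>. It is increasing and linear in the
  weights, and nonnegative when they are. What remains is to pass from quadratic forms to eigenvalues, for which the spectral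
  theorem for real symmetric matrices provides orthonormal eigenbases.

  \<^emph>\<open>Monotonicity.\<close> Raising a weight raises the quadratic form at every vector, so by Weyl's
  monotonicity principle (\<open>eigenvalues_mono\<close>) the \<open>k\<close>-th smallest eigenvalue cannot decrease, for any
  \<open>k\<close>. Hence every summand \<open>f (\<lambda>\<^sub>k\<^sub>1, \<dots>, \<lambda>\<^sub>k\<^sub>m)\<close> grows or stays the same.

  \<^emph>\<open>Convexity.\<close> This is a Peierls-type argument. Let \<open>M = u L + v L'\<close> be a convex combination, with
  orthonormal eigenbasis \<open>q\<close>. Its eigenvalues are \<open>u a\<^sub>i + v b\<^sub>i\<close>, where \<open>a\<^sub>i = q\<^sub>i \<bullet> L q\<^sub>i\<close> and
  \<open>b\<^sub>i = q\<^sub>i \<bullet> L' q\<^sub>i\<close>, so convexity of \<open>f\<close> bounds the spectral sum of \<open>M\<close> by \<open>u\<close> times the sum over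
  tuples of the \<open>a\<^sub>i\<close> plus \<open>v\<close> times the sum over tuples of the \<open>b\<^sub>i\<close>. It remains to see that replacing
  the diagonal entries \<open>a\<^sub>i\<close> by the eigenvalues of \<open>L\<close> can only increase the sum
  (\<open>tuple_sum_diagonal_le\<close>). With an eigenbasis \<open>p\<close> of \<open>L\<close>, the vector \<open>a\<close> is the image of the
  eigenvalues under the doubly stochastic matrix with entries \<open>(p\<^sub>j \<bullet> q\<^sub>i)\<^sup>2\<close>. A tuple of the \<open>a\<^sub>i\<close> is
  then the average of the eigenvalue tuples with respect to a product of rows of this matrix, and
  Jensen's inequality followed by a summation over all tuples gives the claim
  (\<open>tuple_sum_doubly_stochastic\<close>).
\<close>

no_notation Matrix.vec_index (infixl "$" 100)
no_notation inner (infix "\<bullet>" 70)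

section \<open>The spectral theorem for real symmetric matrices\<close>

text \<open>
  For an eigenvector \<open>v\<close> of the complexified matrix \<open>C\<close>, the number \<open>v \<bullet>c C v\<close> can be evaluated by letting the symmetric matrix act
  on either factor, which gives both \<open>a\<close> and its conjugate times the positive number \<open>v \<bullet>c v\<close>.
\<close>

lemma symmetric_complex_eigenvalue_real:
  fixes A :: "real mat"
  assumes A: "A \<in> carrier_mat n n" and sym: "transpose_mat A = A"
    and ev: "eigenvalue (map_mat complex_of_real A) a"
  shows "a \<in> \<real>"
proof -
  let ?C = "map_mat complex_of_real A"
  have C: "?C \<in> carrier_mat n n" using A by simp
  obtain v where v: "v \<in> carrier_vec n" and v0: "v \<noteq> 0\<^sub>v n" and e: "?C *\<^sub>v v = a \<cdot>\<^sub>v v"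
    using ev A unfolding eigenvalue_def eigenvector_def by auto
  have cv: "conjugate v \<in> carrier_vec n" using v by simp
  have Cconj: "?C *\<^sub>v conjugate v = conjugate (?C *\<^sub>v v)"
    using A v by (intro eq_vecI) (auto simp: scalar_prod_def sum_conjugate conjugate_dist_mul)
  have symC: "transpose_mat ?C = ?C"
    using sym by (metis map_mat_transpose)
  have "a * (v \<bullet>c v) = (?C *\<^sub>v v) \<bullet>c v"
    using v by (simp add: e)
  also have "\<dots> = v \<bullet> (?C *\<^sub>v conjugate v)"
    using transpose_vec_mult_scalar[OF C cv v] symC by simp
  also have "\<dots> = cnj a * (v \<bullet>c v)"
    unfolding Cconj e using v by (simp add: conjugate_smult_vec)
  finally have "a = cnj a"
    using v v0 by simp
  then show ?thesis
    by (simp add: Reals_cnj_iff)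
qed

text \<open>
  The characteristic polynomial has a complex root; the root is real, so it is an eigenvalue over
  the reals.
\<close>

lemma symmetric_has_eigenvector:
  fixes A :: "real mat"
  assumes A: "A \<in> carrier_mat n n" and sym: "transpose_mat A = A" and n: "n \<noteq> 0"
  obtains e v where "v \<in> carrier_vec n" "v \<noteq> 0\<^sub>v n" "A *\<^sub>v v = e \<cdot>\<^sub>v v"
proof -
  let ?C = "map_mat complex_of_real A"
  have C: "?C \<in> carrier_mat n n" using A by simp
  have hom: "char_poly ?C = map_poly complex_of_real (char_poly A)"
    by (rule of_real_hom.char_poly_hom[OF A])
  have "degree (char_poly ?C) = n"
    using degree_monic_char_poly[OF C] by simp
  then have "\<not> constant (poly (char_poly ?C))"
    using n by (simp add: constant_degree)
  then obtain a where a: "poly (char_poly ?C) a = 0"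
    using fundamental_theorem_of_algebra by blast
  then have "eigenvalue ?C a"
    using eigenvalue_root_char_poly[OF C] by simp
  then have "a \<in> \<real>"
    by (rule symmetric_complex_eigenvalue_real[OF A sym])
  then obtain e where e: "a = complex_of_real e"
    by (auto elim: Reals_cases)
  have "complex_of_real (poly (char_poly A) e) = 0"
    using a unfolding hom e by simp
  then have "eigenvalue A e"
    using eigenvalue_root_char_poly[OF A] by simp
  then show ?thesis
    using that A unfolding eigenvalue_def eigenvector_def by auto
qed

lemma conjugate_real_vec: "conjugate x = x" for x :: "real Matrix.vec"
  by (intro eq_vecI) auto

text \<open>
  Completing \<open>v\<close> to a basis and orthogonalizing it keeps \<open>v\<close> in front; the columns only have to be
  normalized afterwards.
\<close>

lemma orthogonal_matrix_with_first_column: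
  fixes v :: "real Matrix.vec"
  assumes v: "v \<in> carrier_vec n" and v0: "v \<noteq> 0\<^sub>v n" and n: "n \<noteq> 0"
  obtains W c where "W \<in> carrier_mat n n" "transpose_mat W * W = 1\<^sub>m n" "Matrix.col W 0 = c \<cdot>\<^sub>v v"
proof -
  interpret cof_vec_space n "TYPE(real)" .
  define ws where "ws = gram_schmidt n (basis_completion v)"
  note bc = basis_completion[OF v v0]
  from gram_schmidt_result[OF bc(2,4,5) ws_def]
  have ws: "set ws \<subseteq> carrier_vec n" "corthogonal ws" "length ws = n"
    by (auto simp: bc(6))
  obtain vs where vs: "basis_completion v = v # vs"
    using bc(6,7) n by (cases "basis_completion v") auto
  have "hd ws = v"
    unfolding ws_def vs by (rule gram_schmidt_hd[OF v])
  then have ws0: "ws ! 0 = v"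
    using ws(3) n by (cases ws) auto
  have wsi: "ws ! i \<in> carrier_vec n" if "i < n" for i
    using ws that by auto
  have orth: "ws ! i \<bullet> ws ! j = 0 \<longleftrightarrow> i \<noteq> j" if "i < n" "j < n" for i j
    using corthogonalD[OF ws(2), of i j] ws(3) that by (simp add: conjugate_real_vec)
  define r where "r i = 1 / sqrt (ws ! i \<bullet> ws ! i)" for i
  define W where "W = mat_of_cols n (map (\<lambda>i. r i \<cdot>\<^sub>v ws ! i) [0..<n])"
  have W: "W \<in> carrier_mat n n"
    by (intro carrier_matI) (auto simp: W_def)
  have colW: "Matrix.col W i = r i \<cdot>\<^sub>v ws ! i" if "i < n" for i
    using that wsi[OF that] by (simp add: W_def)
  have "Matrix.col W i \<bullet> Matrix.col W j = (if i = j then 1 else 0)" if "i < n" "j < n" for i j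
  proof -
    have "Matrix.col W i \<bullet> Matrix.col W j = r i * r j * (ws ! i \<bullet> ws ! j)"
      using wsi[OF that(1)] wsi[OF that(2)] that by (simp add: colW)
    moreover have "ws ! i \<bullet> ws ! i > 0"
      using conjugate_square_ge_0_vec[of "ws ! i"] orth[OF that(1) that(1)]
      by (simp add: conjugate_real_vec order_less_le)
    then have "r i * r i * (ws ! i \<bullet> ws ! i) = 1"
      by (simp add: r_def)
    ultimately show ?thesis
      using orth[OF that] by auto
  qed
  then have "transpose_mat W * W = 1\<^sub>m n"
    using W by (intro eq_matI) auto
  moreover have "Matrix.col W 0 = r 0 \<cdot>\<^sub>v v"
    using n by (simp add: colW ws0)
  ultimately show ?thesis
    using that W by blast
qed

text \<open>
  Induction by deflation. Conjugation with an orthogonal matrix whose first column is an eigenvector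
  turns the first column into a multiple of the first unit vector. By symmetry so does the first
  row, and what is left is a symmetric block of size one less.
\<close>

lemma symmetric_orthogonal_diagonalization:
  fixes A :: "real mat"
  assumes "A \<in> carrier_mat n n" and "transpose_mat A = A"
  shows "\<exists>P l. P \<in> carrier_mat n n \<and> transpose_mat P * P = 1\<^sub>m n \<and>
    transpose_mat P * (A * P) = Matrix.mat n n (\<lambda>(i, j). if i = j then l i else 0)"
  using assms
proof (induction n arbitrary: A)
  case 0
  show ?case
    by (rule exI[of _ "1\<^sub>m 0"]) (auto intro!: eq_matI)
next
  case (Suc n)
  note A = Suc.prems(1) and sym = Suc.prems(2)
  obtain e v where v: "v \<in> carrier_vec (Suc n)" "v \<noteq> 0\<^sub>v (Suc n)" and ev: "A *\<^sub>v v = e \<cdot>\<^sub>v v"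
    using symmetric_has_eigenvector[OF A sym] by blast
  obtain W c where W: "W \<in> carrier_mat (Suc n) (Suc n)" and WW: "transpose_mat W * W = 1\<^sub>m (Suc n)"
    and W0: "Matrix.col W 0 = c \<cdot>\<^sub>v v"
    using orthogonal_matrix_with_first_column[OF v] by blast
  have Wt: "transpose_mat W \<in> carrier_mat (Suc n) (Suc n)"
    using W by simp
  define A' where "A' = transpose_mat W * (A * W)"
  have A': "A' \<in> carrier_mat (Suc n) (Suc n)"
    using W A by (simp add: A'_def)
  have symA': "transpose_mat A' = A'"
    using W A Wt sym by (simp add: A'_def transpose_mult[of _ "Suc n" "Suc n" _ "Suc n"])
  have col0: "A' $$ (i, 0) = (if i = 0 then e else 0)" if "i < Suc n" for i
  proof -
    have "A *\<^sub>v Matrix.col W 0 = e \<cdot>\<^sub>v Matrix.col W 0"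
      using v A by (simp add: W0 ev mult_mat_vec[of _ "Suc n" "Suc n"] smult_smult_assoc mult.commute)
    moreover have "Matrix.col (A * W) 0 = A *\<^sub>v Matrix.col W 0"
      using A W by (intro col_mult2) auto
    ultimately have "A' $$ (i, 0) = Matrix.col W i \<bullet> (e \<cdot>\<^sub>v Matrix.col W 0)"
      using that A W by (simp add: A'_def)
    also have "\<dots> = e * (transpose_mat W * W) $$ (i, 0)"
      using that W by simp
    finally show ?thesis
      using that by (simp add: WW)
  qed
  have row0: "A' $$ (0, i) = (if i = 0 then e else 0)" if "i < Suc n" for i
    using col0[OF that] A' that symA' by (metis carrier_matD index_transpose_mat(1) zero_less_Suc)
  define B where "B = Matrix.mat n n (\<lambda>(i, j). A' $$ (Suc i, Suc j))"
  have B: "B \<in> carrier_mat n n"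
    by (simp add: B_def)
  have "A' $$ (Suc i, Suc j) = A' $$ (Suc j, Suc i)" if "i < n" "j < n" for i j
    using A' that symA' by (metis Suc_less_eq carrier_matD index_transpose_mat(1))
  then have symB: "transpose_mat B = B"
    by (intro eq_matI) (auto simp: B_def)
  let ?e = "e \<cdot>\<^sub>m 1\<^sub>m 1"
  have block: "A' = four_block_mat ?e (0\<^sub>m 1 n) (0\<^sub>m n 1) B"
    using A' by (intro eq_matI) (auto simp: B_def col0 row0 gr0_conv_Suc less_Suc_eq_0_disj)
  obtain P l where P: "P \<in> carrier_mat n n" and PP: "transpose_mat P * P = 1\<^sub>m n"
    and PBP: "transpose_mat P * (B * P) = Matrix.mat n n (\<lambda>(i, j). if i = j then l i else 0)"
    using Suc.IH[OF B symB] by blast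
  define Q where "Q = four_block_mat (1\<^sub>m 1) (0\<^sub>m 1 n) (0\<^sub>m n 1) P"
  have Q: "Q \<in> carrier_mat (Suc n) (Suc n)"
    using P by (intro carrier_matI) (auto simp: Q_def)
  have Qt: "transpose_mat Q = four_block_mat (1\<^sub>m 1) (0\<^sub>m 1 n) (0\<^sub>m n 1) (transpose_mat P)"
    using P unfolding Q_def by (subst transpose_four_block_mat) auto
  have Pt: "transpose_mat P \<in> carrier_mat n n"
    using P by simp
  have QQ: "transpose_mat Q * Q = 1\<^sub>m (Suc n)"
    unfolding Qt unfolding Q_def using P Pt PP
    by (subst mult_four_block_mat[of _ 1 1 _ n _ n _ _ 1 _ n]) (auto simp: four_block_one_mat)
  have "A' * Q = four_block_mat ?e (0\<^sub>m 1 n) (0\<^sub>m n 1) (B * P)"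
    unfolding block Q_def using P B
    by (subst mult_four_block_mat[of _ 1 1 _ n _ n _ _ 1 _ n]) auto
  then have "transpose_mat Q * (A' * Q) =
      four_block_mat ?e (0\<^sub>m 1 n) (0\<^sub>m n 1) (transpose_mat P * (B * P))"
    unfolding Qt using P Pt B
    by (simp, subst mult_four_block_mat[of _ 1 1 _ n _ n _ _ 1 _ n]) auto
  also have "\<dots> = Matrix.mat (Suc n) (Suc n)
      (\<lambda>(i, j). if i = j then case_nat e l i else 0)" (is "_ = ?D")
    unfolding PBP by (intro eq_matI) (auto simp: less_Suc_eq_0_disj split: if_splits)
  finally have diag: "transpose_mat Q * (A' * Q) = ?D" .
  have WQ: "W * Q \<in> carrier_mat (Suc n) (Suc n)"
    using W Q by simp
  have Qt': "transpose_mat Q \<in> carrier_mat (Suc n) (Suc n)"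
    using Q by simp
  have tWQ: "transpose_mat (W * Q) = transpose_mat Q * transpose_mat W"
    using W Q by (rule transpose_mult)
  have "transpose_mat (W * Q) * (W * Q) = transpose_mat Q * ((transpose_mat W * W) * Q)"
    unfolding tWQ using W Q Wt Qt' assoc_mult_mat[OF Qt' Wt WQ] by simp
  then have "transpose_mat (W * Q) * (W * Q) = 1\<^sub>m (Suc n)"
    unfolding WW using Q QQ by simp
  moreover have "transpose_mat (W * Q) * (A * (W * Q)) = transpose_mat Q * (A' * Q)"
  proof -
    have "A' * Q = transpose_mat W * (A * W * Q)"
      unfolding A'_def by (rule assoc_mult_mat[OF Wt mult_carrier_mat[OF A W] Q])
    then show ?thesis
      unfolding tWQ assoc_mult_mat[OF Qt' Wt mult_carrier_mat[OF A WQ]]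
      by (simp only: assoc_mult_mat[OF A W Q])
  qed
  ultimately show ?case
    using WQ diag by (intro exI[of _ "W * Q"] exI[of _ "case_nat e l"] conjI) auto
qed

section \<open>Orthonormal eigenbases and quadratic forms\<close>

definition orthonormal_basis :: "nat \<Rightarrow> (nat \<Rightarrow> real Matrix.vec) \<Rightarrow> bool" where
  "orthonormal_basis n p \<longleftrightarrow>
     (\<forall>i<n. p i \<in> carrier_vec n) \<and> (\<forall>i<n. \<forall>j<n. p i \<bullet> p j = (if i = j then 1 else 0))"

text \<open>
  The matrix with columns \<open>p j\<close> satisfies \<open>P\<^sup>T P = 1\<close>, hence also \<open>P P\<^sup>T = 1\<close>, so \<open>P\<^sup>T\<close> preserves
  scalar products.
\<close>

lemma parseval:
  assumes p: "orthonormal_basis n p" and x: "x \<in> carrier_vec n" and y: "y \<in> carrier_vec n"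
  shows "x \<bullet> y = (\<Sum>j<n. (p j \<bullet> x) * (p j \<bullet> y))"
proof -
  define P where "P = mat_of_cols n (map p [0..<n])"
  have P: "P \<in> carrier_mat n n"
    by (intro carrier_matI) (auto simp: P_def)
  then have Pt: "transpose_mat P \<in> carrier_mat n n"
    by simp
  have col: "Matrix.col P i = p i" if "i < n" for i
    using p that by (simp add: P_def orthonormal_basis_def)
  have "transpose_mat P * P = 1\<^sub>m n"
    using p P by (intro eq_matI) (auto simp: col orthonormal_basis_def)
  then have PP: "P * transpose_mat P = 1\<^sub>m n"
    using mat_mult_left_right_inverse[OF Pt P] by simp
  have "x \<bullet> y = x \<bullet> (P *\<^sub>v (transpose_mat P *\<^sub>v y))"
    using assoc_mult_mat_vec[OF P Pt y] y by (simp add: PP)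
  also have "\<dots> = (transpose_mat P *\<^sub>v x) \<bullet> (transpose_mat P *\<^sub>v y)"
    by (rule transpose_vec_mult_scalar[OF P _ x, symmetric]) (use Pt y in auto)
  also have "\<dots> = (\<Sum>j<n. (p j \<bullet> x) * (p j \<bullet> y))"
    using P by (simp add: scalar_prod_def[of "transpose_mat P *\<^sub>v x"] col atLeast0LessThan)
  finally show ?thesis .
qed

definition eigenbasis :: "real mat \<Rightarrow> (nat \<Rightarrow> real) \<Rightarrow> (nat \<Rightarrow> real Matrix.vec) \<Rightarrow> bool" where
  "eigenbasis A l p \<longleftrightarrow>
     orthonormal_basis (dim_row A) p \<and> (\<forall>i<dim_row A. A *\<^sub>v p i = l i \<cdot>\<^sub>v p i)"

lemma quadratic_form_in_eigenbasis:
  assumes A: "A \<in> carrier_mat n n" and sym: "transpose_mat A = A"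
    and p: "eigenbasis A l p" and x: "x \<in> carrier_vec n"
  shows "x \<bullet> (A *\<^sub>v x) = (\<Sum>j<n. l j * (p j \<bullet> x)\<^sup>2)"
proof -
  have onb: "orthonormal_basis n p"
    using p A by (auto simp: eigenbasis_def)
  have "p j \<bullet> (A *\<^sub>v x) = l j * (p j \<bullet> x)" if "j < n" for j
  proof -
    have pj: "p j \<in> carrier_vec n"
      using onb that by (simp add: orthonormal_basis_def)
    have "p j \<bullet> (A *\<^sub>v x) = (A *\<^sub>v p j) \<bullet> x"
      using transpose_vec_mult_scalar[OF A x pj] sym by simp
    then show ?thesis
      using p A that x pj by (simp add: eigenbasis_def)
  qed
  then show ?thesis
    using A x by (subst parseval[OF onb x]) (auto intro!: sum.cong simp: power2_eq_square)
qed

text \<open>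
  An orthogonal diagonalization makes \<open>A\<close> similar to a diagonal matrix, so the diagonal entries are
  the roots of the characteristic polynomial with multiplicity. They may come in any order; a
  permutation of the columns matches them with the sorted list.
\<close>

lemma symmetric_eigenbasis:
  assumes A: "A \<in> carrier_mat n n" and sym: "transpose_mat A = A"
  shows "length (eigenvalue_list A) = n"
    and "\<exists>p. eigenbasis A ((!) (eigenvalue_list A)) p"
proof -
  obtain P l where P: "P \<in> carrier_mat n n" and PP: "transpose_mat P * P = 1\<^sub>m n"
    and diag: "transpose_mat P * (A * P) = Matrix.mat n n (\<lambda>(i, j). if i = j then l i else 0)"
      (is "_ = ?D")
    using symmetric_orthogonal_diagonalization[OF A sym] by blast
  have Pt: "transpose_mat P \<in> carrier_mat n n"
    using P by simp
  have D: "?D \<in> carrier_mat n n"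
    by simp
  have PPt: "P * transpose_mat P = 1\<^sub>m n"
    using mat_mult_left_right_inverse[OF Pt P PP] .
  have "P * ?D = (P * transpose_mat P) * (A * P)"
    unfolding diag[symmetric]
    by (rule assoc_mult_mat[OF P Pt mult_carrier_mat[OF A P], symmetric])
  then have AP: "A * P = P * ?D"
    using P A by (simp add: PPt)
  have "P * ?D * transpose_mat P = A * (P * transpose_mat P)"
    unfolding AP[symmetric] using A P Pt by simp
  then have "A = P * ?D * transpose_mat P"
    using A by (simp add: PPt)
  then have "similar_mat A ?D"
    using A P Pt PP PPt
    unfolding similar_mat_def similar_mat_wit_def Let_def
    by (intro exI[of _ P] exI[of _ "transpose_mat P"]) auto
  then have "char_poly A = char_poly ?D"
    by (rule char_poly_similar)
  also have "\<dots> = (\<Prod>a\<leftarrow>diag_mat ?D. [:- a, 1:])"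
    by (rule char_poly_upper_triangular[OF D]) (auto simp: upper_triangular_def)
  also have "diag_mat ?D = map l [0..<n]"
    by (simp add: diag_mat_def)
  finally have cp: "char_poly A = (\<Prod>a\<leftarrow>map l [0..<n]. [:- a, 1:])" .
  have nonzero: "(\<Prod>a\<leftarrow>as. [:- a, 1:]) \<noteq> 0" for as :: "real list"
    by (induction as) (auto simp del: mult_pCons_left)
  have "proots (\<Prod>a\<leftarrow>as. [:- a, 1:]) = mset as" for as :: "real list"
  proof (induction as)
    case (Cons a as)
    have "proots ([:- a, 1:] * (\<Prod>a\<leftarrow>as. [:- a, 1:])) =
        proots [:- a, 1:] + proots (\<Prod>a\<leftarrow>as. [:- a, 1:])"
      by (rule proots_mult) (use nonzero in auto)
    then show ?case
      unfolding list.map prod_list.Cons Cons.IH by simp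
  qed simp
  then have mset: "mset (eigenvalue_list A) = mset (map l [0..<n])"
    unfolding eigenvalue_list_def cp by (simp only: mset_sorted_list_of_multiset)
  then show len: "length (eigenvalue_list A) = n"
    by (metis size_mset length_map length_upt minus_nat.diff_0)
  obtain \<pi> where \<pi>: "\<pi> permutes {..<length (map l [0..<n])}"
    and perm: "permute_list \<pi> (map l [0..<n]) = eigenvalue_list A"
    using mset_eq_permutation[OF mset] by blast
  have \<pi>n: "\<pi> i < n" if "i < n" for i
    using permutes_in_image[OF \<pi>, of i] that by simp
  have ev: "eigenvalue_list A ! i = l (\<pi> i)" if "i < n" for i
    unfolding perm[symmetric] using permute_list_nth[OF \<pi>, of i] that \<pi>n[OF that] by simp
  have inj: "\<pi> i = \<pi> j \<longleftrightarrow> i = j" for i j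
    using permutes_inj[OF \<pi>] by (auto dest: injD)
  have eig: "A *\<^sub>v Matrix.col P i = l i \<cdot>\<^sub>v Matrix.col P i" if "i < n" for i
  proof -
    have "A *\<^sub>v Matrix.col P i = Matrix.col (P * ?D) i"
      unfolding AP[symmetric] using that P A by (intro col_mult2[symmetric]) auto
    also have "\<dots> = l i \<cdot>\<^sub>v Matrix.col P i"
      using that P by (intro eq_vecI) (auto simp: scalar_prod_def if_distrib cong: if_cong)
    finally show ?thesis .
  qed
  have "Matrix.col P i \<bullet> Matrix.col P j = (transpose_mat P * P) $$ (i, j)" if "i < n" "j < n" for i j
    using that P by simp
  then have "orthonormal_basis n (\<lambda>i. Matrix.col P (\<pi> i))"
    using P by (auto simp: orthonormal_basis_def PP \<pi>n inj)
  then have "eigenbasis A ((!) (eigenvalue_list A)) (\<lambda>i. Matrix.col P (\<pi> i))"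
    using A by (auto simp: eigenbasis_def ev eig \<pi>n)
  then show "\<exists>p. eigenbasis A ((!) (eigenvalue_list A)) p"
    by blast
qed

lemma sorted_eigenvalue_list: "sorted (eigenvalue_list A)"
  by (simp add: eigenvalue_list_def)


section \<open>Weyl's monotonicity principle\<close>

text \<open>
  Fewer conditions than unknowns: the matrix of the conditions, with row \<open>k\<close> set to zero, is
  square and singular. Filling up with a zero row avoids any counting of dimensions.
\<close>

lemma exists_nonzero_orthogonal_vector:
  fixes a :: "nat \<Rightarrow> real Matrix.vec"
  assumes a: "\<And>i. i < n \<Longrightarrow> a i \<in> carrier_vec n" and k: "k < n"
  shows "\<exists>x \<in> carrier_vec n. x \<noteq> 0\<^sub>v n \<and> (\<forall>i<n. i \<noteq> k \<longrightarrow> a i \<bullet> x = 0)"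
proof -
  define M where "M = mat\<^sub>r n n (\<lambda>i. if i = k then 0\<^sub>v n else a i)"
  have M: "M \<in> carrier_mat n n"
    by (simp add: M_def)
  have row: "Matrix.row M i = a i" if "i < n" "i \<noteq> k" for i
    using that a[OF that(1)] by (simp add: M_def)
  have "det M = 0"
    unfolding M_def by (rule det_row_0[OF k]) (use a in auto)
  then obtain x where x: "x \<in> carrier_vec n" "x \<noteq> 0\<^sub>v n" "M *\<^sub>v x = 0\<^sub>v n"
    using det_0_iff_vec_prod_zero_field[OF M] by blast
  have "a i \<bullet> x = 0" if i: "i < n" "i \<noteq> k" for i
  proof -
    have "a i \<bullet> x = vec_index (M *\<^sub>v x) i"
      using M i by (simp add: row)
    then show ?thesis
      using i by (simp add: x(3))
  qed
  with x show ?thesis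
    by blast
qed

text \<open>
  Let \<open>x \<noteq> 0\<close> be orthogonal to the eigenvectors of \<open>A\<close> with index below \<open>k\<close> and to those of \<open>B\<close> with
  index above \<open>k\<close>; these are only \<open>n - 1\<close> conditions. Only eigenvalues of \<open>A\<close> from the \<open>k\<close>-th on
  contribute to the form of \<open>A\<close> at \<open>x\<close>, and only eigenvalues of \<open>B\<close> up to the \<open>k\<close>-th to the form of
  \<open>B\<close>, so that \<open>\<lambda>\<^sub>k(A) |x|\<^sup>2 \<le> x \<bullet> A x \<le> x \<bullet> B x \<le> \<lambda>\<^sub>k(B) |x|\<^sup>2\<close>.
\<close>

lemma eigenvalues_mono:
  assumes A: "A \<in> carrier_mat n n" and symA: "transpose_mat A = A"
    and B: "B \<in> carrier_mat n n" and symB: "transpose_mat B = B"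
    and le: "\<And>x. x \<in> carrier_vec n \<Longrightarrow> x \<bullet> (A *\<^sub>v x) \<le> x \<bullet> (B *\<^sub>v x)"
    and k: "k < n"
  shows "eigenvalue_list A ! k \<le> eigenvalue_list B ! k"
proof -
  obtain p where p: "eigenbasis A ((!) (eigenvalue_list A)) p"
    using symmetric_eigenbasis(2)[OF A symA] by blast
  obtain q where q: "eigenbasis B ((!) (eigenvalue_list B)) q"
    using symmetric_eigenbasis(2)[OF B symB] by blast
  have pb: "orthonormal_basis n p" and qb: "orthonormal_basis n q"
    using p q A B by (auto simp: eigenbasis_def)
  have car: "(if i < k then p i else q i) \<in> carrier_vec n" if "i < n" for i
    using pb qb that by (simp add: orthonormal_basis_def)
  obtain x where x: "x \<in> carrier_vec n" "x \<noteq> 0\<^sub>v n"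
    and orth: "\<And>i. i < n \<Longrightarrow> i \<noteq> k \<Longrightarrow> (if i < k then p i else q i) \<bullet> x = 0"
    using exists_nonzero_orthogonal_vector[of n "\<lambda>i. if i < k then p i else q i", OF car k] by blast
  have norm: "x \<bullet> x = (\<Sum>j<n. (b j \<bullet> x)\<^sup>2)" if "orthonormal_basis n b" for b
    using parseval[OF that x(1) x(1)] by (simp add: power2_eq_square)
  have "eigenvalue_list A ! k * (x \<bullet> x) = (\<Sum>j<n. eigenvalue_list A ! k * (p j \<bullet> x)\<^sup>2)"
    by (simp add: norm[OF pb] sum_distrib_left)
  also have "\<dots> \<le> (\<Sum>j<n. eigenvalue_list A ! j * (p j \<bullet> x)\<^sup>2)"
  proof (rule sum_mono)
    fix j assume "j \<in> {..<n}"
    then show "eigenvalue_list A ! k * (p j \<bullet> x)\<^sup>2 \<le> eigenvalue_list A ! j * (p j \<bullet> x)\<^sup>2"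
      using orth[of j] sorted_nth_mono[OF sorted_eigenvalue_list, of k j A] symmetric_eigenbasis(1)[OF A symA]
      by (cases "j < k") (auto intro: mult_right_mono)
  qed
  also have "\<dots> \<le> (\<Sum>j<n. eigenvalue_list B ! j * (q j \<bullet> x)\<^sup>2)"
    using le[OF x(1)]
    by (simp add: quadratic_form_in_eigenbasis[OF A symA p x(1)]
        quadratic_form_in_eigenbasis[OF B symB q x(1)])
  also have "\<dots> \<le> (\<Sum>j<n. eigenvalue_list B ! k * (q j \<bullet> x)\<^sup>2)"
  proof (rule sum_mono)
    fix j assume "j \<in> {..<n}"
    then show "eigenvalue_list B ! j * (q j \<bullet> x)\<^sup>2 \<le> eigenvalue_list B ! k * (q j \<bullet> x)\<^sup>2"
      using orth[of j] sorted_nth_mono[OF sorted_eigenvalue_list, of j k B] symmetric_eigenbasis(1)[OF B symB] k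
      by (cases "j \<le> k") (auto intro: mult_right_mono)
  qed
  also have "\<dots> = eigenvalue_list B ! k * (x \<bullet> x)"
    by (simp add: norm[OF qb] sum_distrib_left)
  finally have "eigenvalue_list A ! k * (x \<bullet> x) \<le> eigenvalue_list B ! k * (x \<bullet> x)" .
  moreover have "0 < x \<bullet> x"
    using conjugate_square_greater_0_vec[OF x(1)] x(2) by (simp add: conjugate_real_vec)
  ultimately show ?thesis
    by simp
qed

lemma eigenvalues_nonneg:
  assumes A: "A \<in> carrier_mat n n" and sym: "transpose_mat A = A"
    and psd: "\<And>x. x \<in> carrier_vec n \<Longrightarrow> 0 \<le> x \<bullet> (A *\<^sub>v x)" and k: "k < n"
  shows "0 \<le> eigenvalue_list A ! k"
proof -
  obtain p where p: "eigenbasis A ((!) (eigenvalue_list A)) p"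
    using symmetric_eigenbasis(2)[OF A sym] by blast
  then have pk: "p k \<in> carrier_vec n" "p k \<bullet> p k = 1" "A *\<^sub>v p k = eigenvalue_list A ! k \<cdot>\<^sub>v p k"
    using A k by (auto simp: eigenbasis_def orthonormal_basis_def)
  then show ?thesis
    using psd[OF pk(1)] by simp
qed

section \<open>Sums over all tuples of arguments\<close>

text \<open>
  The spectral sum with an arbitrary sequence in place of the eigenvalues, so that it can be
  evaluated at the diagonal entries of a matrix in some orthonormal basis.
\<close>

definition tuple_sum :: "(real ^ 'm \<Rightarrow> real) \<Rightarrow> nat \<Rightarrow> (nat \<Rightarrow> real) \<Rightarrow> real" where
  "tuple_sum f n a = (\<Sum>k \<in> {k :: 'm \<Rightarrow> nat. \<forall>j. k j < n}. f (\<chi> j. a (k j)))"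

lemma spectral_sum_eq:
  "A \<in> carrier_mat n n \<Longrightarrow> spectral_sum f A = tuple_sum f n ((!) (eigenvalue_list A))"
  by (simp add: spectral_sum_def tuple_sum_def)

text \<open>The coordinates are raised one after the other.\<close>

lemma increasing_in_each_input_mono:
  fixes f :: "real ^ 'm \<Rightarrow> real"
  assumes f: "increasing_in_each_input f" and x: "x \<in> nonneg_orthant" and le: "\<And>i. x $ i \<le> y $ i"
  shows "f x \<le> f y"
proof -
  have "f x \<le> f (\<chi> i. if i \<in> S then y $ i else x $ i)" if "finite S" for S :: "'m set"
    using that
  proof induction
    case empty
    then show ?case by (simp add: vec_nth_inverse)
  next
    case (insert a S)
    let ?z = "\<chi> i. if i \<in> S then y $ i else x $ i"
    have "?z \<in> nonneg_orthant"
      using x le by (auto simp: nonneg_orthant_def intro: order_trans)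
    moreover have "?z $ a \<le> y $ a"
      using le by simp
    ultimately have "f ?z \<le> f (\<chi> j. if j = a then y $ a else ?z $ j)"
      using f unfolding increasing_in_each_input_def by blast
    also have "(\<chi> j. if j = a then y $ a else ?z $ j) = (\<chi> i. if i \<in> insert a S then y $ i else x $ i)"
      by (auto simp: Finite_Cartesian_Product.vec_eq_iff)
    finally show ?case
      using insert.IH by simp
  qed
  from this[of UNIV] show ?thesis
    by simp
qed

lemma finite_index_families: "finite {k :: 'm::finite \<Rightarrow> nat. \<forall>j. k j < n}"
  using finite_PiE[of "UNIV :: 'm set" "\<lambda>_. {..<n}"] by (simp add: PiE_UNIV_domain Pi_def)

text \<open>
  Write \<open>S\<close> for the doubly stochastic matrix. For fixed \<open>k\<close>, the products
  \<open>\<Prod>r. S (k r) (h r)\<close> are the probabilities of the tuples \<open>h\<close> when the entries \<open>h r\<close> are drawn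
  independently according to the rows \<open>k r\<close> of \<open>S\<close>. The expected tuple \<open>(l (h r))\<^sub>r\<close> is the argument of
  \<open>f\<close> on the left, so Jensen's inequality applies. Since the columns of \<open>S\<close> also sum to 1, the total
  weight that a tuple \<open>h\<close> receives over all \<open>k\<close> is 1.
\<close>

lemma tuple_sum_doubly_stochastic:
  fixes f :: "real ^ 'm \<Rightarrow> real"
  assumes f: "convex_on nonneg_orthant f"
    and l: "\<And>j. j < n \<Longrightarrow> 0 \<le> l j"
    and S: "\<And>i j. i < n \<Longrightarrow> j < n \<Longrightarrow> 0 \<le> S i j"
    and rows: "\<And>i. i < n \<Longrightarrow> (\<Sum>j<n. S i j) = (1::real)"
    and cols: "\<And>j. j < n \<Longrightarrow> (\<Sum>i<n. S i j) = 1"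
  shows "tuple_sum f n (\<lambda>i. \<Sum>j<n. S i j * l j) \<le> tuple_sum f n l"
proof -
  let ?K = "{k :: 'm \<Rightarrow> nat. \<forall>j. k j < n}"
  have K: "?K = PiE UNIV (\<lambda>_. {..<n})"
    by (auto simp: PiE_UNIV_domain)
  have weights: "(\<Sum>h\<in>?K. \<Prod>r\<in>UNIV. T r (h r)) = (\<Prod>r\<in>UNIV. \<Sum>j<n. T r j)" for T :: "'m \<Rightarrow> nat \<Rightarrow> real"
    unfolding K by (rule prod_sum_PiE[symmetric]) auto
  have jensen: "f (\<chi> r. \<Sum>j<n. S (k r) j * l j) \<le> (\<Sum>h\<in>?K. (\<Prod>r\<in>UNIV. S (k r) (h r)) * f (\<chi> r. l (h r)))"
    if k: "k \<in> ?K" for k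
  proof -
    have k': "k r < n" for r
      using k by simp
    have one: "(\<Sum>h\<in>?K. \<Prod>r\<in>UNIV. S (k r) (h r)) = 1"
      by (simp only: weights[of "\<lambda>r. S (k r)"] rows[OF k'] prod.neutral_const)
    \<comment> \<open>The expectation of the coordinate \<open>h i\<close>: the factors of the product with \<open>r \<noteq> i\<close> sum to 1.\<close>
    have coord: "(\<Sum>h\<in>?K. (\<Prod>r\<in>UNIV. S (k r) (h r)) * l (h i)) = (\<Sum>j<n. S (k i) j * l j)" for i
    proof -
      let ?T = "\<lambda>r j. S (k r) j * (if r = i then l j else 1)"
      have "(\<Prod>r\<in>UNIV. S (k r) (h r)) * l (h i) = (\<Prod>r\<in>UNIV. ?T r (h r))" for h
        by (simp add: prod.distrib)
      then have "(\<Sum>h\<in>?K. (\<Prod>r\<in>UNIV. S (k r) (h r)) * l (h i)) = (\<Prod>r\<in>UNIV. \<Sum>j<n. ?T r j)"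
        by (simp only: weights[of ?T])
      also have "\<dots> = (\<Prod>r\<in>UNIV. if r = i then \<Sum>j<n. S (k i) j * l j else 1)"
        by (intro prod.cong) (auto simp: rows[OF k'])
      finally show ?thesis
        by simp
    qed
    have "(\<chi> r. \<Sum>j<n. S (k r) j * l j) = (\<Sum>h\<in>?K. (\<Prod>r\<in>UNIV. S (k r) (h r)) *\<^sub>R (\<chi> r. l (h r)))"
      by (simp add: Finite_Cartesian_Product.vec_eq_iff coord)
    moreover have "f (\<Sum>h\<in>?K. (\<Prod>r\<in>UNIV. S (k r) (h r)) *\<^sub>R (\<chi> r. l (h r)))
        \<le> (\<Sum>h\<in>?K. (\<Prod>r\<in>UNIV. S (k r) (h r)) * f (\<chi> r. l (h r)))"
      by (rule convex_on_sum[OF finite_index_families _ f one])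
         (use k k' S l in \<open>auto intro!: prod_nonneg simp: nonneg_orthant_def\<close>)
    ultimately show ?thesis
      by simp
  qed
  have "tuple_sum f n (\<lambda>i. \<Sum>j<n. S i j * l j)
      \<le> (\<Sum>k\<in>?K. \<Sum>h\<in>?K. (\<Prod>r\<in>UNIV. S (k r) (h r)) * f (\<chi> r. l (h r)))"
    unfolding tuple_sum_def by (rule sum_mono[OF jensen])
  also have "\<dots> = (\<Sum>h\<in>?K. (\<Sum>k\<in>?K. \<Prod>r\<in>UNIV. S (k r) (h r)) * f (\<chi> r. l (h r)))"
    by (subst sum.swap) (simp add: sum_distrib_right)
  also have "\<dots> = tuple_sum f n l"
    unfolding tuple_sum_def
  proof (rule sum.cong)
    fix h :: "'m \<Rightarrow> nat" assume "h \<in> ?K"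
    then have "(\<Sum>k\<in>?K. \<Prod>r\<in>UNIV. S (k r) (h r)) = 1"
      using weights[of "\<lambda>r j. S j (h r)"] by (simp add: cols)
    then show "(\<Sum>k\<in>?K. \<Prod>r\<in>UNIV. S (k r) (h r)) * f (\<chi> r. l (h r)) = f (\<chi> r. l (h r))"
      by simp
  qed simp
  finally show ?thesis .
qed

text \<open>
  The diagonal entries of \<open>A\<close> in the basis \<open>q\<close> are averages of the eigenvalues with weights
  \<open>(p j \<bullet> q i)\<^sup>2\<close>. By Parseval's identity in the basis \<open>p\<close> and in the basis \<open>q\<close>, these weights form a
  doubly stochastic matrix. Positive semidefiniteness keeps all arguments of \<open>f\<close> in the orthant,
  where \<open>f\<close> is convex.
\<close>

lemma tuple_sum_diagonal_le:
  fixes f :: "real ^ 'm \<Rightarrow> real"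
  assumes f: "convex_on nonneg_orthant f"
    and A: "A \<in> carrier_mat n n" and sym: "transpose_mat A = A"
    and psd: "\<And>x. x \<in> carrier_vec n \<Longrightarrow> 0 \<le> x \<bullet> (A *\<^sub>v x)"
    and q: "orthonormal_basis n q"
  shows "tuple_sum f n (\<lambda>i. q i \<bullet> (A *\<^sub>v q i)) \<le> spectral_sum f A"
proof -
  obtain p where p: "eigenbasis A ((!) (eigenvalue_list A)) p"
    using symmetric_eigenbasis(2)[OF A sym] by blast
  then have pb: "orthonormal_basis n p"
    using A by (auto simp: eigenbasis_def)
  have car: "p i \<in> carrier_vec n" "q i \<in> carrier_vec n" "p i \<bullet> p i = 1" "q i \<bullet> q i = 1" if "i < n" for i
    using pb q that by (auto simp: orthonormal_basis_def)
  have "tuple_sum f n (\<lambda>i. q i \<bullet> (A *\<^sub>v q i)) =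
      tuple_sum f n (\<lambda>i. \<Sum>j<n. (p j \<bullet> q i)\<^sup>2 * eigenvalue_list A ! j)"
    unfolding tuple_sum_def
    by (intro sum.cong refl arg_cong[where f = f])
       (simp add: Finite_Cartesian_Product.vec_eq_iff quadratic_form_in_eigenbasis[OF A sym p] car mult.commute)
  also have "\<dots> \<le> tuple_sum f n ((!) (eigenvalue_list A))"
  proof (rule tuple_sum_doubly_stochastic[OF f])
    fix i assume i: "i < n"
    show "0 \<le> eigenvalue_list A ! i"
      by (rule eigenvalues_nonneg[OF A sym psd i])
    show "(\<Sum>j<n. (p j \<bullet> q i)\<^sup>2) = 1"
      using parseval[OF pb car(2)[OF i] car(2)[OF i]] car(4)[OF i] by (simp add: power2_eq_square)
    have "(\<Sum>j<n. (p i \<bullet> q j)\<^sup>2) = (\<Sum>j<n. (q j \<bullet> p i)\<^sup>2)"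
      using car i by (intro sum.cong) (auto simp: comm_scalar_prod[of "p i" n])
    then show "(\<Sum>j<n. (p i \<bullet> q j)\<^sup>2) = 1"
      using parseval[OF q car(1)[OF i] car(1)[OF i]] car(3)[OF i] by (simp add: power2_eq_square)
  qed simp
  finally show ?thesis
    by (simp add: spectral_sum_eq[OF A])
qed

section \<open>The quadratic form of the Laplacian\<close>

lemma laplacian_carrier: "laplacian n E w \<in> carrier_mat n n"
  by (simp add: laplacian_def)

lemma weight_commute: "weight E w i j = weight E w j i"
  by (simp add: weight_def insert_commute)

lemma laplacian_symmetric: "transpose_mat (laplacian n E w) = laplacian n E w"
  by (intro eq_matI) (auto simp: laplacian_def weight_commute)

text \<open>
  The form is \<open>\<Sum>i j. w i j * (x i - x j) * x i\<close>; averaging this with the sum in which \<open>i\<close> and \<open>j\<close> are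
  exchanged gives the squares. The absence of loops matters: a loop would contribute to the diagonal
  of the Laplacian without a matching term off the diagonal.
\<close>

lemma laplacian_quadratic_form:
  assumes E: "simple_graph n E" and x: "x \<in> carrier_vec n"
  shows "x \<bullet> (laplacian n E w *\<^sub>v x) =
    (\<Sum>i<n. \<Sum>j<n. weight E w i j * (vec_index x i - vec_index x j)\<^sup>2) / 2"
proof -
  let ?a = "\<lambda>i j. weight E w i j" and ?x = "\<lambda>i. vec_index x i"
  have loop: "?a i i = 0" for i
    using E by (auto simp: weight_def simple_graph_def)
  have entry: "vec_index (laplacian n E w *\<^sub>v x) i = (\<Sum>j<n. ?a i j * (?x i - ?x j))" if i: "i < n" for i
  proof -
    have "vec_index (laplacian n E w *\<^sub>v x) i =
        (\<Sum>j<n. (if i = j then \<Sum>k<n. ?a i k else - ?a i j) * ?x j)"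
      using i x by (simp add: laplacian_def scalar_prod_def atLeast0LessThan)
    also have "\<dots> = (\<Sum>j<n. (if j = i then (\<Sum>k<n. ?a i k) * ?x i else 0) - ?a i j * ?x j)"
      by (intro sum.cong) (auto simp: loop)
    also have "\<dots> = (\<Sum>j<n. ?a i j) * ?x i - (\<Sum>j<n. ?a i j * ?x j)"
      using i by (simp add: sum_subtractf)
    also have "\<dots> = (\<Sum>j<n. ?a i j * (?x i - ?x j))"
      by (simp add: sum_subtractf sum_distrib_right right_diff_distrib)
    finally show ?thesis .
  qed
  have "x \<bullet> (laplacian n E w *\<^sub>v x) = (\<Sum>i<n. \<Sum>j<n. ?a i j * (?x i - ?x j) * ?x i)" (is "?q = ?s")
    using laplacian_carrier[of n E w]
    by (simp add: scalar_prod_def atLeast0LessThan entry sum_distrib_left mult_ac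
        del: index_mult_mat_vec)
  moreover have "?s = (\<Sum>i<n. \<Sum>j<n. ?a i j * (?x j - ?x i) * ?x j)"
    by (subst sum.swap) (simp add: weight_commute[of E w])
  ultimately have "2 * ?q =
      (\<Sum>i<n. \<Sum>j<n. ?a i j * (?x i - ?x j) * ?x i) +
      (\<Sum>i<n. \<Sum>j<n. ?a i j * (?x j - ?x i) * ?x j)"
    by simp
  also have "\<dots> = (\<Sum>i<n. \<Sum>j<n. ?a i j * (?x i - ?x j)\<^sup>2)"
    by (simp add: sum.distrib[symmetric] power2_eq_square algebra_simps)
  finally show ?thesis
    by simp
qed

lemma laplacian_form_mono:
  assumes E: "simple_graph n E" and x: "x \<in> carrier_vec n" and le: "\<And>e. e \<in> E \<Longrightarrow> w e \<le> w' e"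
  shows "x \<bullet> (laplacian n E w *\<^sub>v x) \<le> x \<bullet> (laplacian n E w' *\<^sub>v x)"
  unfolding laplacian_quadratic_form[OF E x]
  by (intro divide_right_mono sum_mono mult_right_mono) (auto simp: weight_def le)

lemma laplacian_psd:
  assumes E: "simple_graph n E" and x: "x \<in> carrier_vec n" and w: "w \<in> nonneg_weights E"
  shows "0 \<le> x \<bullet> (laplacian n E w *\<^sub>v x)"
  unfolding laplacian_quadratic_form[OF E x]
  using w by (intro divide_nonneg_nonneg sum_nonneg mult_nonneg_nonneg) (auto simp: weight_def nonneg_weights_def)

lemma laplacian_form_linear:
  assumes E: "simple_graph n E" and x: "x \<in> carrier_vec n"
  shows "x \<bullet> (laplacian n E (\<lambda>e. u * w e + v * w' e) *\<^sub>v x) =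
    u * (x \<bullet> (laplacian n E w *\<^sub>v x)) + v * (x \<bullet> (laplacian n E w' *\<^sub>v x))"
proof -
  have "weight E (\<lambda>e. u * w e + v * w' e) i j = u * weight E w i j + v * weight E w' i j" for i j
    by (simp add: weight_def)
  then show ?thesis
    unfolding laplacian_quadratic_form[OF E x]
    by (simp add: sum.distrib sum_distrib_left distrib_right add_divide_distrib mult.assoc)
qed

section \<open>Monotonicity and convexity in the edge weights\<close>

lemma spectral_sum_increasing_in_weights:
  fixes f :: "real ^ 'm \<Rightarrow> real"
  assumes E: "simple_graph n E" and f: "increasing_in_each_input f"
  shows "increasing_in_weights E (\<lambda>w. spectral_sum f (laplacian n E w))"
  unfolding increasing_in_weights_def
proof (intro ballI allI impI)
  fix w e t
  assume w: "w \<in> nonneg_weights E" and "e \<in> E" and t: "w e \<le> t"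
  let ?L = "laplacian n E w" and ?L' = "laplacian n E (w(e := t))"
  have mono: "eigenvalue_list ?L ! k \<le> eigenvalue_list ?L' ! k" if "k < n" for k
    using that t
    by (intro eigenvalues_mono[of _ n] laplacian_form_mono[OF E] laplacian_carrier laplacian_symmetric) auto
  have nonneg: "0 \<le> eigenvalue_list ?L ! k" if "k < n" for k
    using eigenvalues_nonneg[OF laplacian_carrier laplacian_symmetric laplacian_psd[OF E _ w] that] .
  show "spectral_sum f ?L \<le> spectral_sum f ?L'"
    unfolding spectral_sum_eq[OF laplacian_carrier] tuple_sum_def
    by (intro sum_mono increasing_in_each_input_mono[OF f]) (auto simp: nonneg_orthant_def mono nonneg)
qed

lemma spectral_sum_convex_in_weights:
  fixes f :: "real ^ 'm \<Rightarrow> real"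
  assumes E: "simple_graph n E" and f: "convex_on nonneg_orthant f"
  shows "convex_in_weights E (\<lambda>w. spectral_sum f (laplacian n E w))"
  unfolding convex_in_weights_def
proof (intro ballI allI impI)
  fix w w' and u v :: real
  assume w: "w \<in> nonneg_weights E" and w': "w' \<in> nonneg_weights E"
    and uv: "0 \<le> u" "0 \<le> v" "u + v = 1"
  let ?L = "laplacian n E w" and ?L' = "laplacian n E w'"
    and ?M = "laplacian n E (\<lambda>e. u * w e + v * w' e)"
  obtain q where q: "eigenbasis ?M ((!) (eigenvalue_list ?M)) q"
    using symmetric_eigenbasis(2)[OF laplacian_carrier laplacian_symmetric] by blast
  then have qb: "orthonormal_basis n q"
    by (simp add: eigenbasis_def carrier_matD(1)[OF laplacian_carrier])
  let ?a = "\<lambda>i. q i \<bullet> (?L *\<^sub>v q i)" and ?b = "\<lambda>i. q i \<bullet> (?L' *\<^sub>v q i)"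
  have qi: "q i \<in> carrier_vec n" if "i < n" for i
    using qb that by (simp add: orthonormal_basis_def)
  \<comment> \<open>The eigenvalue is the value of the quadratic form at the unit eigenvector, and this value is
     linear in the weights.\<close>
  have ev: "eigenvalue_list ?M ! i = u * ?a i + v * ?b i" if i: "i < n" for i
  proof -
    have "q i \<bullet> (?M *\<^sub>v q i) = eigenvalue_list ?M ! i"
      using q qb i qi[OF i]
      by (simp add: eigenbasis_def orthonormal_basis_def carrier_matD(1)[OF laplacian_carrier])
    then show ?thesis
      by (simp add: laplacian_form_linear[OF E qi[OF i]])
  qed
  have "spectral_sum f ?M = tuple_sum f n (\<lambda>i. u * ?a i + v * ?b i)"
    unfolding spectral_sum_eq[OF laplacian_carrier] tuple_sum_def
    by (intro sum.cong refl arg_cong[where f = f]) (simp add: Finite_Cartesian_Product.vec_eq_iff ev)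
  also have "\<dots> \<le> u * tuple_sum f n ?a + v * tuple_sum f n ?b"
    unfolding tuple_sum_def sum_distrib_left sum.distrib[symmetric]
  proof (rule sum_mono)
    fix k :: "'m \<Rightarrow> nat" assume k: "k \<in> {k. \<forall>j. k j < n}"
    have "(\<chi> j. u * ?a (k j) + v * ?b (k j)) = u *\<^sub>R (\<chi> j. ?a (k j)) + v *\<^sub>R (\<chi> j. ?b (k j))"
      by (simp add: Finite_Cartesian_Product.vec_eq_iff)
    moreover have "(\<chi> j. ?a (k j)) \<in> nonneg_orthant" "(\<chi> j. ?b (k j)) \<in> nonneg_orthant"
      using k by (auto simp: nonneg_orthant_def intro!: laplacian_psd[OF E _ w] laplacian_psd[OF E _ w'] qi)
    ultimately show "f (\<chi> j. u * ?a (k j) + v * ?b (k j)) \<le> u * f (\<chi> j. ?a (k j)) + v * f (\<chi> j. ?b (k j))"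
      using f uv unfolding convex_on_def by simp
  qed
  also have "\<dots> \<le> u * spectral_sum f ?L + v * spectral_sum f ?L'"
    using uv laplacian_psd[OF E _ w] laplacian_psd[OF E _ w']
    by (intro add_mono mult_left_mono tuple_sum_diagonal_le[OF f laplacian_carrier laplacian_symmetric _ qb]) auto
  finally show "spectral_sum f ?M \<le> u * spectral_sum f ?L + v * spectral_sum f ?L'" .
qed

theorem proposition3p1:
  fixes n :: nat and E :: "nat set set" and f :: "real ^ 'm \<Rightarrow> real"
  assumes "simple_graph n E"
  shows "(C_k_on CARD('m) f nonneg_orthant \<and> increasing_in_each_input f \<longrightarrow>
            increasing_in_weights E (\<lambda>w. spectral_sum f (laplacian n E w))) \<and>
         (C_k_on 0 f nonneg_orthant \<and> convex_on nonneg_orthant f \<longrightarrow>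
            convex_in_weights E (\<lambda>w. spectral_sum f (laplacian n E w)))"
  using spectral_sum_increasing_in_weights[OF assms] spectral_sum_convex_in_weights[OF assms] by blast

end
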